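(* Let $G$ be a locally compact group with a left invariant proper metric $d$ generating its topology, and let $\nu$ be a nondegenerate Borel probability measure on $G$ with first moment. If $(G,\nu)$ is Liouville, then there is a $1$-Lipschitz homomorphism $T:G\to\mathbb{R}$ such that for almost every trajectory $Z_n$ of the random walk driven by $\nu$, $$\lim_{n\to\infty}\frac1n T(Z_n)=\int_G T(g)\,d\nu(g)=\ell(\nu).$$
   Context: Proper: closed bounded subsets are compact. $\nu$ has a first moment if $\int_G d(e,g)\,d\nu(g)<\infty$; $\nu$ is nondegenerate if the closed subgroup generated by its support is $G$. The random walk is $Z_n=g_0g_1\cdots g_{n-1}$ with $g_i$ independent of law $\nu$; its linear drift $\ell(\nu)\ge0$ is the number such that almost surely $\lim_n\frac1n d(e,Z_n)=\ell(\nu)$. A bounded measurable $f:G\to\mathbb{R}$ is $\nu$-harmonic if $f(g)=\int_G f(gh)\,d\nu(h)$ for every $g\in G$. $(G,\nu)$ is Liouville if the constant functions are the only bounded $\nu$-harmonic functions. $1$-Lipschitz is with respect to $d$ on $G$ and the usual distance on $\mathbb{R}$. *)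

theory Defs
  imports "HOL-Probability.Probability"
begin

text \<open>
  Groups are written additively: the class \<^class>\<open>group_add\<close> does not assume commutativity, so
  \<open>0\<close> is the identity \<open>e\<close>, \<open>g + h\<close> the product \<open>gh\<close>, and \<open>- g\<close> the inverse.  The metric is
  \<^const>\<open>dist\<close>, which in \<^class>\<open>metric_space\<close> generates the topology.
\<close>

definition left_invariant_metric :: "'a::{metric_space, group_add} itself \<Rightarrow> bool" where
  "left_invariant_metric _ \<longleftrightarrow> (\<forall>g x y :: 'a. dist (g + x) (g + y) = dist x y)"

definition proper_metric :: "'a::metric_space itself \<Rightarrow> bool" where
  "proper_metric _ \<longleftrightarrow> (\<forall>S :: 'a set. closed S \<and> bounded S \<longrightarrow> compact S)"

definition measure_support :: "'a::topological_space measure \<Rightarrow> 'a set" where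
  "measure_support \<nu> = {x. \<forall>U. open U \<and> x \<in> U \<longrightarrow> emeasure \<nu> U > 0}"

definition closed_subgroup :: "'a::{topological_space, group_add} set \<Rightarrow> bool" where
  "closed_subgroup H \<longleftrightarrow>
     closed H \<and> 0 \<in> H \<and> (\<forall>x\<in>H. \<forall>y\<in>H. x + y \<in> H) \<and> (\<forall>x\<in>H. - x \<in> H)"

definition nondegenerate :: "'a::{topological_space, group_add} measure \<Rightarrow> bool" where
  "nondegenerate \<nu> \<longleftrightarrow> closed_subgroup hull (measure_support \<nu>) = UNIV"

definition has_first_moment :: "'a::{metric_space, group_add} measure \<Rightarrow> bool" where
  "has_first_moment \<nu> \<longleftrightarrow> (\<integral>\<^sup>+ g. ennreal (dist 0 g) \<partial>\<nu>) < \<infinity>"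

definition bounded_harmonic :: "'a::{topological_space, group_add} measure \<Rightarrow> ('a \<Rightarrow> real) \<Rightarrow> bool"
  where "bounded_harmonic \<nu> f \<longleftrightarrow>
     f \<in> borel_measurable borel \<and> bounded (range f) \<and> (\<forall>g. f g = (\<integral>h. f (g + h) \<partial>\<nu>))"

definition liouville :: "'a::{topological_space, group_add} measure \<Rightarrow> bool" where
  "liouville \<nu> \<longleftrightarrow> (\<forall>f. bounded_harmonic \<nu> f \<longrightarrow> (\<exists>c. \<forall>g. f g = c))"

text \<open>The increments \<open>g\<^sub>0, g\<^sub>1, \<dots>\<close> are the coordinates of \<open>\<omega>\<close> in the infinite product of \<open>\<nu>\<close>.\<close>

definition increments :: "'a measure \<Rightarrow> (nat \<Rightarrow> 'a) measure" where
  "increments \<nu> = (\<Pi>\<^sub>M i\<in>UNIV. \<nu>)"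

definition random_walk :: "nat \<Rightarrow> (nat \<Rightarrow> 'a::monoid_add) \<Rightarrow> 'a" where
  "random_walk n \<omega> = sum_list (map \<omega> [0..<n])"

text \<open>
  For an iid walk with first moment the limit exists almost surely and is deterministic
  (Kingman's subadditive ergodic theorem); without such an \<open>l\<close> the value is unspecified.
\<close>

definition linear_drift :: "'a::{metric_space, group_add} measure \<Rightarrow> real" where
  "linear_drift \<nu> =
     (THE l. AE \<omega> in increments \<nu>. (\<lambda>n. dist 0 (random_walk n \<omega>) / real n) \<longlonglongrightarrow> l)"

end

theory Submission
  imports Defs "HOL-Complex_Analysis.Great_Picard"
begin

text \<open>
  The homomorphism is a limit of averaged horofunctions.  Let \<open>D\<^sub>n(g)\<close> be the mean of
  \<open>d(e, g Z\<^sub>n) = d(g\<^sup>-\<^sup>1, Z\<^sub>n)\<close>, and let \<open>P f(g) = \<integral> f(g h) d\<nu>(h)\<close> be the Markov operator.  Splitting off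
  the first increment of the walk gives \<open>P D\<^sub>n = D\<^sub>n\<^sub>+\<^sub>1\<close>.  Hence the averages \<open>\<psi>\<^sub>N\<close> of
  \<open>D\<^sub>n - D\<^sub>n(e)\<close> over \<open>n < N\<close> satisfy \<open>P \<psi>\<^sub>N = \<psi>\<^sub>N + (D\<^sub>N - D\<^sub>0) / N\<close>.  They are equicontinuous and
  pointwise bounded, so by properness (through separability) some subsequence converges pointwise to a
  function \<open>\<phi>\<close>, along which moreover \<open>D\<^sub>N(e) / N\<close> converges to a number \<open>l\<close>.  The first moment
  permits passing to the limit under the integral: \<open>P \<phi> = \<phi> + l\<close>
  (\<open>exists_quasi_harmonic_horofunction\<close>).

  For a fixed group element \<open>k\<close>, the difference \<open>\<phi>(k g) - \<phi>(g)\<close> is then harmonic in \<open>g\<close>, and the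
  triangle inequality bounds it by \<open>d(e, k)\<close>.  By the Liouville property it is constant, that
  is, \<open>\<phi>\<close> is a homomorphism \<open>T\<close> with \<open>\<bar>T(g)\<bar> \<le> d(e, g)\<close>, which for a homomorphism is the same as being
  1-Lipschitz.  Evaluating \<open>P \<phi> = \<phi> + l\<close> at the identity gives \<open>\<integral> T d\<nu> = l\<close>
  (\<open>liouville_imp_drift_homomorphism\<close>).

  It remains to identify \<open>l\<close> with the almost sure drift.  A subadditive process driven by independent
  increments almost surely grows at most at any rate that exceeds its mean rate at some time
  (\<open>subadditive_process_upper_growth\<close>, by a maximal ergodic argument).  Applied to \<open>d(e, Z\<^sub>n)\<close> this bounds
  the speed above by \<open>l\<close>; applied to \<open>- T(Z\<^sub>n)\<close> it bounds the growth rate of \<open>T(Z\<^sub>n)\<close> below by \<open>l\<close>.  As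
  \<open>T(Z\<^sub>n) \<le> d(e, Z\<^sub>n)\<close>, both rates equal \<open>l\<close>.
\<close>

section \<open>Separability, measurability and averages\<close>

lemma proper_imp_countable_dense:
  assumes "proper_metric TYPE('a::metric_space)"
  obtains D :: "'a::metric_space set" where "countable D" "\<And>x e. e > 0 \<Longrightarrow> \<exists>y\<in>D. dist x y < e"
proof -
  have "\<exists>K. finite K \<and> cball (undefined::'a) (real n) \<subseteq> (\<Union>x\<in>K. ball x (1 / Suc m))" for n m :: nat
  proof -
    have "compact (cball (undefined::'a) (real n))"
      using assms unfolding proper_metric_def by simp
    then show ?thesis
      unfolding compact_eq_totally_bounded by (metis of_nat_0_less_iff zero_less_Suc zero_less_divide_1_iff)
  qed
  then obtain K where K: "\<And>n m. finite (K n m)"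
      "\<And>n m. cball (undefined::'a) (real n) \<subseteq> (\<Union>x\<in>K n m. ball x (1 / Suc m))"
    by metis
  show thesis
  proof
    show "countable (\<Union>n m. K n m)"
      using K(1) by (intro countable_UN) (auto intro: countable_finite)
    fix x :: 'a and e :: real assume "e > 0"
    obtain n where "dist undefined x \<le> real n"
      using real_arch_simple by blast
    moreover obtain m where m: "1 / Suc m < e"
      using \<open>e > 0\<close> by (metis nat_approx_posE)
    ultimately obtain y where "y \<in> K n m" "dist y x < 1 / Suc m"
      using K(2)[of n m] by auto
    then show "\<exists>y\<in>(\<Union>n m. K n m). dist x y < e"
      using m by (metis UN_I UNIV_I dist_commute order.strict_trans)
  qed
qed

text \<open>
  The Borel sets of a product of separable metric spaces are generated by rectangles, because an
  open subset of the product is a countable union of rectangles of balls centred in a countable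
  dense set.  Separability is a hypothesis here rather than a type class, since for a group with a
  proper metric it is derived from properness; applied to the group operation, the lemma makes
  the random walk measurable.
\<close>

lemma borel_measurable_continuous_on_pair:
  fixes f :: "'a::metric_space \<times> 'a \<Rightarrow> 'b::topological_space"
  assumes "countable D" and dense: "\<And>(x::'a) e. e > 0 \<Longrightarrow> \<exists>y\<in>D. dist x y < e"
    and f: "continuous_on UNIV f"
  shows "f \<in> borel \<Otimes>\<^sub>M borel \<rightarrow>\<^sub>M borel"
proof (rule borel_measurableI)
  fix U :: "'b set" assume "open U"
  then have op: "open (f -` U)"
    using f by (simp add: continuous_on_open_vimage)
  define I where "I = {(a, b, n). a \<in> D \<and> b \<in> D \<and> ball a (1 / Suc n) \<times> ball b (1 / Suc n) \<subseteq> f -` U}"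
  have "I \<subseteq> D \<times> D \<times> UNIV"
    by (auto simp: I_def)
  then have "countable I"
    using \<open>countable D\<close> by (meson countable_SIGMA countable_subset uncountable_def countableI_type)
  have "f -` U \<subseteq> (\<Union>(a, b, n)\<in>I. ball a (1 / Suc n) \<times> ball b (1 / Suc n))"
  proof
    fix p assume "p \<in> f -` U"
    then obtain A B where AB: "open A" "open B" "fst p \<in> A" "snd p \<in> B" "A \<times> B \<subseteq> f -` U"
      using open_prod_elim[OF op, of p] by (metis mem_Times_iff)
    then obtain e1 e2 where e: "e1 > 0" "ball (fst p) e1 \<subseteq> A" "e2 > 0" "ball (snd p) e2 \<subseteq> B"
      by (meson openE)
    obtain n where n: "1 / real (Suc n) < min e1 e2 / 2"
      using e by (metis half_gt_zero min_less_iff_conj nat_approx_posE)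
    obtain a b where ab: "a \<in> D" "dist (fst p) a < 1 / real (Suc n)" "b \<in> D" "dist (snd p) b < 1 / real (Suc n)"
      using dense by (metis of_nat_0_less_iff zero_less_Suc zero_less_divide_1_iff)
    have "ball a (1 / Suc n) \<subseteq> A"
    proof
      fix z assume "z \<in> ball a (1 / Suc n)"
      then have "dist (fst p) z < e1"
        using ab(2) n dist_triangle[of "fst p" z a] by (auto simp del: of_nat_Suc)
      then show "z \<in> A" using e by auto
    qed
    moreover have "ball b (1 / Suc n) \<subseteq> B"
    proof
      fix z assume "z \<in> ball b (1 / Suc n)"
      then have "dist (snd p) z < e2"
        using ab(4) n dist_triangle[of "snd p" z b] by (auto simp del: of_nat_Suc)
      then show "z \<in> B" using e by auto
    qed
    ultimately have "(a, b, n) \<in> I"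
      using ab AB(5) by (auto simp: I_def)
    then show "p \<in> (\<Union>(a, b, n)\<in>I. ball a (1 / Suc n) \<times> ball b (1 / Suc n))"
      using ab by (intro UN_I[of "(a, b, n)"]) (auto simp: mem_Times_iff dist_commute simp del: of_nat_Suc)
  qed
  then have "f -` U = (\<Union>(a, b, n)\<in>I. ball a (1 / Suc n) \<times> ball b (1 / Suc n))"
    by (auto simp: I_def)
  also have "\<dots> \<in> sets (borel \<Otimes>\<^sub>M borel)"
    using \<open>countable I\<close> by (intro sets.countable_UN'') auto
  finally show "f -` U \<inter> space (borel \<Otimes>\<^sub>M borel) \<in> sets (borel \<Otimes>\<^sub>M borel)"
    by (simp add: space_pair_measure)
qed

text \<open>
  The equicontinuity half of Arzela-Ascoli: for uniformly Lipschitz functions, convergence spreads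
  from a dense set to every point.
\<close>

lemma convergent_if_lipschitz_and_convergent_on_dense:
  fixes u :: "nat \<Rightarrow> 'a::metric_space \<Rightarrow> real"
  assumes lip: "\<And>n x y. \<bar>u n x - u n y\<bar> \<le> dist x y"
    and dense: "\<And>e. e > 0 \<Longrightarrow> \<exists>y\<in>D. dist x y < e"
    and conv: "\<And>y. y \<in> D \<Longrightarrow> convergent (\<lambda>n. u n y)"
  shows "convergent (\<lambda>n. u n x)"
  unfolding Cauchy_convergent_iff[symmetric]
proof (rule metric_CauchyI)
  fix e :: real assume "e > 0"
  then obtain y where y: "y \<in> D" "dist x y < e / 3"
    using dense[of "e / 3"] by auto
  have "Cauchy (\<lambda>n. u n y)"
    using conv[OF y(1)] by (simp add: Cauchy_convergent_iff)
  then obtain N where N: "\<And>m n. m \<ge> N \<Longrightarrow> n \<ge> N \<Longrightarrow> dist (u m y) (u n y) < e / 3"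
    using \<open>e > 0\<close> by (metis metric_CauchyD zero_less_divide_iff zero_less_numeral)
  have "dist (u m x) (u n x) < e" if "m \<ge> N" "n \<ge> N" for m n
    using N[OF that] lip[of m x y] lip[of n x y] y(2) unfolding dist_real_def by linarith
  then show "\<exists>N. \<forall>m\<ge>N. \<forall>n\<ge>N. dist (u m x) (u n x) < e"
    by blast
qed

lemma (in prob_space) expectation_diff_bound:
  fixes u v :: "'a \<Rightarrow> real"
  assumes "integrable M u" "integrable M v" "\<And>\<omega>. \<bar>u \<omega> - v \<omega>\<bar> \<le> c"
  shows "\<bar>expectation u - expectation v\<bar> \<le> c"
proof -
  have "\<bar>expectation u - expectation v\<bar> = \<bar>\<integral>\<omega>. u \<omega> - v \<omega> \<partial>M\<bar>"
    using assms by simp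
  also have "\<dots> \<le> (\<integral>\<omega>. \<bar>u \<omega> - v \<omega>\<bar> \<partial>M)"
    by (rule integral_abs_bound)
  also have "\<dots> \<le> (\<integral>\<omega>. c \<partial>M)"
    using assms by (intro integral_mono) auto
  finally show ?thesis by (simp add: prob_space)
qed

lemma average_diff_bound:
  assumes "\<And>n. \<bar>u n - v n\<bar> \<le> c"
  shows "\<bar>(\<Sum>n<N. u n - w n) / real N - (\<Sum>n<N. v n - w n) / real N\<bar> \<le> (c :: real)"
proof -
  have "0 \<le> c" using assms[of 0] by linarith
  have "\<bar>\<Sum>n<N. u n - v n\<bar> \<le> real N * c"
    using sum_norm_bound[of "{..<N}" "\<lambda>n. u n - v n" c] assms by simp
  moreover have "(\<Sum>n<N. u n - w n) / real N - (\<Sum>n<N. v n - w n) / real N = (\<Sum>n<N. u n - v n) / real N"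
    by (simp add: diff_divide_distrib[symmetric] sum_subtractf[symmetric])
  ultimately show ?thesis
    using \<open>0 \<le> c\<close> by (cases "N = 0") (auto simp: abs_divide divide_le_eq mult.commute)
qed

section \<open>Subadditive processes over independent increments\<close>

context sequence_space
begin

lemma comb_seq_shift: "(\<lambda>i. comb_seq m \<omega> \<omega>' (m + i)) = \<omega>'"
  by (simp add: comb_seq_def)

lemma measurable_shift: "(\<lambda>\<omega> i. \<omega> (m + i)) \<in> S \<rightarrow>\<^sub>M S"
  by (rule measurable_PiM_single') (auto simp: space_PiM PiE_iff)

lemma distr_shift: "distr S S (\<lambda>\<omega> i. \<omega> (m + i)) = S"
proof -
  have "distr S S (\<lambda>\<omega> i. \<omega> (m + i)) = distr (distr (S \<Otimes>\<^sub>M S) S (\<lambda>(\<omega>, \<omega>'). comb_seq m \<omega> \<omega>')) S (\<lambda>\<omega> i. \<omega> (m + i))"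
    by (simp only: PiM_comb_seq)
  also have "\<dots> = distr (S \<Otimes>\<^sub>M S) S snd"
    by (subst distr_distr[OF measurable_shift measurable_comb_seq])
       (auto intro!: distr_cong simp: comb_seq_shift)
  also have "\<dots> = S"
  proof (rule measure_eqI)
    fix A assume "A \<in> sets (distr (S \<Otimes>\<^sub>M S) S snd)"
    then have A: "A \<in> sets S" by simp
    have "snd -` A \<inter> space (S \<Otimes>\<^sub>M S) = space S \<times> A"
      using sets.sets_into_space[OF A] by (auto simp: space_pair_measure)
    then show "emeasure (distr (S \<Otimes>\<^sub>M S) S snd) A = emeasure S A"
      using A by (simp add: emeasure_distr P.emeasure_pair_measure_Times P.emeasure_space_1)
  qed simp
  finally show ?thesis .
qed

lemma integral_mult_shift:
  fixes f g :: "(nat \<Rightarrow> 'a) \<Rightarrow> real"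
  assumes f: "integrable S f" and dep: "\<And>\<omega> \<omega>'. f (comb_seq m \<omega> \<omega>') = f \<omega>"
    and g: "integrable S g"
  shows "(\<integral>\<omega>. f \<omega> * g (\<lambda>i. \<omega> (m + i)) \<partial>S) = (\<integral>\<omega>. f \<omega> \<partial>S) * (\<integral>\<omega>. g \<omega> \<partial>S)"
proof -
  interpret SS: pair_sigma_finite S S ..
  note [measurable] = measurable_shift measurable_comb_seq borel_measurable_integrable[OF f] borel_measurable_integrable[OF g]
  have "(\<integral>\<omega>. f \<omega> * g (\<lambda>i. \<omega> (m + i)) \<partial>S)
      = (\<integral>\<omega>. f \<omega> * g (\<lambda>i. \<omega> (m + i)) \<partial>distr (S \<Otimes>\<^sub>M S) S (\<lambda>(\<omega>, \<omega>'). comb_seq m \<omega> \<omega>'))"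
    by (simp only: PiM_comb_seq)
  also have "\<dots> = (\<integral>p. f (fst p) * g (snd p) \<partial>(S \<Otimes>\<^sub>M S))"
    by (subst integral_distr) (auto simp: split_beta' dep comb_seq_shift)
  also have "\<dots> = (\<integral>\<omega>. (\<integral>\<omega>'. f \<omega> * g \<omega>' \<partial>S) \<partial>S)"
  proof -
    have "integrable (S \<Otimes>\<^sub>M S) (\<lambda>p. f (fst p) * g (snd p))"
    proof (rule SS.Fubini_integrable)
      show "(\<lambda>p. f (fst p) * g (snd p)) \<in> borel_measurable (S \<Otimes>\<^sub>M S)"
        by measurable
      have "(\<integral>\<omega>'. norm (f (fst (\<omega>, \<omega>')) * g (snd (\<omega>, \<omega>'))) \<partial>S) = \<bar>f \<omega>\<bar> * (\<integral>\<omega>'. \<bar>g \<omega>'\<bar> \<partial>S)" for \<omega>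
        by (simp add: abs_mult)
      then show "integrable S (\<lambda>\<omega>. \<integral>\<omega>'. norm (f (fst (\<omega>, \<omega>')) * g (snd (\<omega>, \<omega>'))) \<partial>S)"
        using integrable_abs[OF f] by simp
      show "AE \<omega> in S. integrable S (\<lambda>\<omega>'. f (fst (\<omega>, \<omega>')) * g (snd (\<omega>, \<omega>')))"
        using g by simp
    qed
    from SS.integral_fst'[OF this] show ?thesis by simp
  qed
  also have "\<dots> = (\<integral>\<omega>. f \<omega> \<partial>S) * (\<integral>\<omega>. g \<omega> \<partial>S)"
    by simp
  finally show ?thesis .
qed

text \<open>
  This is Garsia's argument for the maximal ergodic lemma, in a subadditive form that serves both for
  the distance of a walk from its origin and for sums of independent variables.  Let \<open>\<theta>\<close> be the shift by \<open>m\<close>,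
  \<open>peak n\<close> the maximum of \<open>Y 0, \<dots>, Y n\<close>, and \<open>A\<close> the event that \<open>Y\<close> is unbounded above.
  Subadditivity gives \<open>A \<subseteq> \<theta>\<^sup>-\<^sup>1 A\<close> and
  \<open>peak (n + m) - peak n \<circ> \<theta> \<le> max (peak m - peak n \<circ> \<theta>) (Y m)\<close>.
  Integrated over \<open>\<theta>\<^sup>-\<^sup>1 A\<close>, the left side is nonnegative because \<open>\<theta>\<close> preserves the measure,
  while the right side tends to \<open>Y m\<close> there.  Hence \<open>Y m\<close> has a nonnegative integral over
  \<open>\<theta>\<^sup>-\<^sup>1 A\<close>.  But \<open>Y m\<close> depends on the first \<open>m\<close> coordinates only and \<open>\<theta>\<^sup>-\<^sup>1 A\<close> on the others,
  so this integral is \<open>P A\<close> times the negative mean of \<open>Y m\<close>, and \<open>P A = 0\<close>.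
\<close>

lemma subadditive_process_bdd_above:
  fixes Y :: "nat \<Rightarrow> (nat \<Rightarrow> 'a) \<Rightarrow> real"
  assumes int: "\<And>n. integrable S (Y n)"
    and zero: "\<And>\<omega>. Y 0 \<omega> = 0"
    and sub: "\<And>n \<omega>. Y (m + n) \<omega> \<le> Y m \<omega> + Y n (\<lambda>i. \<omega> (m + i))"
    and dep: "\<And>\<omega> \<omega>'. Y m (comb_seq m \<omega> \<omega>') = Y m \<omega>"
    and neg: "(\<integral>\<omega>. Y m \<omega> \<partial>S) < 0"
  shows "AE \<omega> in S. \<exists>K. \<forall>n. Y n \<omega> \<le> K"
proof -
  define \<theta> :: "(nat \<Rightarrow> 'a) \<Rightarrow> nat \<Rightarrow> 'a" where "\<theta> \<omega> = (\<lambda>i. \<omega> (m + i))" for \<omega>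
  define peak where "peak n \<omega> = (MAX j\<in>{..n}. Y j \<omega>)" for n \<omega>
  define A where "A = {\<omega> \<in> space S. \<forall>k::nat. \<exists>n. Y n \<omega> > real k}"
  have Y_le: "Y j \<omega> \<le> peak n \<omega>" if "j \<le> n" for j n \<omega>
    unfolding peak_def using that by (intro Max_ge) auto
  have peak_le: "peak n \<omega> \<le> c" if "\<And>j. j \<le> n \<Longrightarrow> Y j \<omega> \<le> c" for n \<omega> c
    unfolding peak_def using that by (intro Max.boundedI) auto
  have peak_nonneg: "0 \<le> peak n \<omega>" for n \<omega>
    using Y_le[of 0 n \<omega>] zero[of \<omega>] by simp
  have peak_mono: "peak k \<omega> \<le> peak n \<omega>" if "k \<le> n" for k n \<omega>
    using that by (intro peak_le Y_le) auto
  have peak_Suc: "peak (Suc n) = (\<lambda>\<omega>. max (Y (Suc n) \<omega>) (peak n \<omega>))" for n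
    unfolding peak_def by (simp add: atMost_Suc fun_eq_iff)
  have int_peak: "integrable S (peak n)" for n
  proof (induction n)
    case 0
    then show ?case using int[of 0] by (simp add: peak_def cong: integrable_cong)
  next
    case (Suc n)
    then show ?case unfolding peak_Suc using int by (intro integrable_max) auto
  qed
  have Ymeas [measurable]: "Y n \<in> borel_measurable S" for n
    using int[of n] by auto
  have peak_meas [measurable]: "peak n \<in> borel_measurable S" for n
    using int_peak[of n] by auto
  have \<theta>meas [measurable]: "\<theta> \<in> S \<rightarrow>\<^sub>M S"
    unfolding \<theta>_def by (rule measurable_shift)
  have A_sets [measurable]: "A \<in> sets S"
    unfolding A_def by measurable
  define a :: "(nat \<Rightarrow> 'a) \<Rightarrow> real" where "a = indicator A"
  have ameas [measurable]: "a \<in> borel_measurable S"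
    unfolding a_def by measurable
  have a01: "0 \<le> a \<omega>" "a \<omega> \<le> 1" for \<omega>
    by (auto simp: a_def indicator_def)
  have step: "peak (n + m) \<omega> \<le> max (peak m \<omega>) (Y m \<omega> + peak n (\<theta> \<omega>))" for n \<omega>
  proof (rule peak_le)
    fix j assume j: "j \<le> n + m"
    show "Y j \<omega> \<le> max (peak m \<omega>) (Y m \<omega> + peak n (\<theta> \<omega>))"
    proof (cases "j \<le> m")
      case True then show ?thesis using Y_le[of j m \<omega>] by simp
    next
      case False
      then have "Y j \<omega> \<le> Y m \<omega> + Y (j - m) (\<theta> \<omega>)"
        using sub[of "j - m" \<omega>] by (simp add: \<theta>_def)
      moreover have "Y (j - m) (\<theta> \<omega>) \<le> peak n (\<theta> \<omega>)"
        using j by (intro Y_le) auto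
      ultimately show ?thesis by simp
    qed
  qed
  \<comment> \<open>If \<open>Y\<close> is bounded along \<open>\<theta> \<omega>\<close>, then by subadditivity it is bounded along \<open>\<omega>\<close>.\<close>
  have A_shift: "a \<omega> \<le> a (\<theta> \<omega>)" if \<omega>: "\<omega> \<in> space S" for \<omega>
  proof (rule ccontr)
    assume "\<not> ?thesis"
    then have *: "\<omega> \<in> A" "\<theta> \<omega> \<notin> A"
      by (auto simp: a_def indicator_def split: if_splits)
    moreover have "\<theta> \<omega> \<in> space S"
      using measurable_space[OF \<theta>meas \<omega>] .
    ultimately obtain k :: nat where k: "\<And>n. Y n (\<theta> \<omega>) \<le> real k"
      by (auto simp: A_def not_less)
    obtain l :: nat where l: "max (peak m \<omega>) (Y m \<omega> + real k) \<le> real l"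
      using real_arch_simple by blast
    have "Y n \<omega> \<le> real l" for n
    proof -
      have "Y n \<omega> \<le> peak (n + m) \<omega>" by (rule Y_le) simp
      also have "\<dots> \<le> max (peak m \<omega>) (Y m \<omega> + peak n (\<theta> \<omega>))" by (rule step)
      also have "\<dots> \<le> max (peak m \<omega>) (Y m \<omega> + real k)"
        using peak_le[of n "\<theta> \<omega>" "real k"] k by auto
      finally show ?thesis using l by (rule order_trans)
    qed
    moreover have "\<exists>n. real l < Y n \<omega>"
      using *(1) unfolding A_def by blast
    ultimately show False
      by (meson not_le)
  qed
  have int_shift: "integrable S (\<lambda>\<omega>. f (\<theta> \<omega>))" "(\<integral>\<omega>. f (\<theta> \<omega>) \<partial>S) = (\<integral>\<omega>. f \<omega> \<partial>S)"
    if f: "integrable S f" for f :: "_ \<Rightarrow> real"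
  proof -
    have d: "distr S S \<theta> = S"
      using distr_shift[of m] unfolding \<theta>_def .
    show "integrable S (\<lambda>\<omega>. f (\<theta> \<omega>))"
      using integrable_distr[OF \<theta>meas, of f] f d by simp
    show "(\<integral>\<omega>. f (\<theta> \<omega>) \<partial>S) = (\<integral>\<omega>. f \<omega> \<partial>S)"
      using integral_distr[OF \<theta>meas, of f] f d by simp
  qed
  have int_a: "integrable S (\<lambda>\<omega>. a \<omega> * f \<omega>)" "integrable S (\<lambda>\<omega>. a (\<theta> \<omega>) * f \<omega>)"
    if "integrable S f" for f :: "_ \<Rightarrow> real"
  proof -
    show "integrable S (\<lambda>\<omega>. a \<omega> * f \<omega>)"
      by (rule Bochner_Integration.integrable_bound[OF that])
        (use that in \<open>auto simp: a_def indicator_def\<close>)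
    show "integrable S (\<lambda>\<omega>. a (\<theta> \<omega>) * f \<omega>)"
      by (rule Bochner_Integration.integrable_bound[OF that])
        (use that in \<open>auto simp: a_def indicator_def\<close>)
  qed
  define G where "G n \<omega> = max (peak m \<omega> - peak n (\<theta> \<omega>)) (Y m \<omega>)" for n \<omega>
  have int_G: "integrable S (G n)" for n
    unfolding G_def by (intro integrable_max Bochner_Integration.integrable_diff int_peak int int_shift)
  \<comment> \<open>Shift invariance turns the integral of \<open>peak n \<circ> \<theta>\<close> over \<open>\<theta>\<^sup>-\<^sup>1 A\<close> into that of \<open>peak n\<close> over \<open>A\<close>.\<close>
  have "0 \<le> (\<integral>\<omega>. a (\<theta> \<omega>) * G n \<omega> \<partial>S)" for n
  proof -
    have "(\<integral>\<omega>. a (\<theta> \<omega>) * peak n (\<theta> \<omega>) \<partial>S) = (\<integral>\<omega>. a \<omega> * peak n \<omega> \<partial>S)"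
      using int_shift(2)[OF int_a(1)[OF int_peak]] .
    also have "\<dots> \<le> (\<integral>\<omega>. a (\<theta> \<omega>) * peak (n + m) \<omega> \<partial>S)"
      using A_shift peak_mono peak_nonneg a01
      by (intro integral_mono int_a int_peak mult_mono) auto
    also have "\<dots> \<le> (\<integral>\<omega>. a (\<theta> \<omega>) * (G n \<omega> + peak n (\<theta> \<omega>)) \<partial>S)"
    proof (intro integral_mono int_a int_peak mult_left_mono a01 Bochner_Integration.integrable_add int_G int_shift)
      show "peak (n + m) \<omega> \<le> G n \<omega> + peak n (\<theta> \<omega>)" for \<omega>
        using step[of n \<omega>] unfolding G_def by linarith
    qed
    also have "\<dots> = (\<integral>\<omega>. a (\<theta> \<omega>) * G n \<omega> \<partial>S) + (\<integral>\<omega>. a (\<theta> \<omega>) * peak n (\<theta> \<omega>) \<partial>S)"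
      unfolding distrib_left by (intro Bochner_Integration.integral_add int_a int_G int_shift int_peak)
    finally show ?thesis by simp
  qed
  moreover have "(\<lambda>n. \<integral>\<omega>. a (\<theta> \<omega>) * G n \<omega> \<partial>S) \<longlonglongrightarrow> (\<integral>\<omega>. a (\<theta> \<omega>) * Y m \<omega> \<partial>S)"
  proof (rule integral_dominated_convergence[where w = "\<lambda>\<omega>. peak m \<omega> + \<bar>Y m \<omega>\<bar>"])
    show "integrable S (\<lambda>\<omega>. peak m \<omega> + \<bar>Y m \<omega>\<bar>)"
      using int_peak int by auto
    show "AE \<omega> in S. norm (a (\<theta> \<omega>) * G n \<omega>) \<le> peak m \<omega> + \<bar>Y m \<omega>\<bar>" for n
    proof (rule AE_I2)
      fix \<omega>
      have "\<bar>G n \<omega>\<bar> \<le> peak m \<omega> + \<bar>Y m \<omega>\<bar>"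
        using peak_nonneg[of m \<omega>] peak_nonneg[of n "\<theta> \<omega>"] unfolding G_def by linarith
      then show "norm (a (\<theta> \<omega>) * G n \<omega>) \<le> peak m \<omega> + \<bar>Y m \<omega>\<bar>"
        using peak_nonneg[of m \<omega>] by (auto simp: a_def indicator_def)
    qed
    show "AE \<omega> in S. (\<lambda>n. a (\<theta> \<omega>) * G n \<omega>) \<longlonglongrightarrow> a (\<theta> \<omega>) * Y m \<omega>"
    proof (rule AE_I2)
      fix \<omega>
      show "(\<lambda>n. a (\<theta> \<omega>) * G n \<omega>) \<longlonglongrightarrow> a (\<theta> \<omega>) * Y m \<omega>"
      proof (cases "\<theta> \<omega> \<in> A")
        case True
        obtain k :: nat where k: "peak m \<omega> - Y m \<omega> \<le> real k"
          using real_arch_simple by blast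
        obtain n0 where n0: "Y n0 (\<theta> \<omega>) > real k"
          using True by (auto simp: A_def)
        \<comment> \<open>On \<open>\<theta>\<^sup>-\<^sup>1 A\<close> the peaks along \<open>\<theta> \<omega>\<close> grow beyond \<open>peak m \<omega> - Y m \<omega>\<close>.\<close>
        have "G n \<omega> = Y m \<omega>" if "n \<ge> n0" for n
          using Y_le[OF that, of "\<theta> \<omega>"] n0 k unfolding G_def by linarith
        then have "\<forall>\<^sub>F n in sequentially. a (\<theta> \<omega>) * G n \<omega> = a (\<theta> \<omega>) * Y m \<omega>"
          by (auto simp: eventually_sequentially)
        then show ?thesis by (rule tendsto_eventually)
      qed (simp add: a_def)
    qed
  qed (use int_G in \<open>auto simp: G_def\<close>)
  ultimately have "0 \<le> (\<integral>\<omega>. a (\<theta> \<omega>) * Y m \<omega> \<partial>S)"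
    by (meson LIMSEQ_le_const)
  also have "\<dots> = (\<integral>\<omega>. Y m \<omega> * a (\<theta> \<omega>) \<partial>S)"
    by (simp add: mult.commute)
  also have "\<dots> = (\<integral>\<omega>. Y m \<omega> \<partial>S) * (\<integral>\<omega>. a \<omega> \<partial>S)"
    unfolding \<theta>_def by (intro integral_mult_shift int dep) (simp add: a_def P.emeasure_eq_measure)
  finally have "measure S A = 0"
    using neg measure_nonneg[of S A] by (auto simp: a_def zero_le_mult_iff)
  then have "AE \<omega> in S. \<omega> \<notin> A"
    by (intro AE_not_in) (auto simp: null_sets_def P.emeasure_eq_measure)
  then show ?thesis
    by (rule AE_mp) (auto simp: A_def not_less intro!: AE_I2)
qed

text \<open>
  Subtracting a drift \<open>c n\<close> with \<open>c\<close> above the mean growth rate leaves a process with a negative mean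
  at some time, which is almost surely bounded above; so \<open>W n\<close> grows at rate at most \<open>c\<close>.
  The exceptional null sets are united over the countably many \<open>c = L + 1 / (k + 1)\<close>.
\<close>

lemma subadditive_process_upper_growth:
  fixes W :: "nat \<Rightarrow> (nat \<Rightarrow> 'a) \<Rightarrow> real"
  assumes int: "\<And>n. integrable S (W n)"
    and zero: "\<And>\<omega>. W 0 \<omega> = 0"
    and sub: "\<And>m n \<omega>. W (m + n) \<omega> \<le> W m \<omega> + W n (\<lambda>i. \<omega> (m + i))"
    and dep: "\<And>m \<omega> \<omega>'. W m (comb_seq m \<omega> \<omega>') = W m \<omega>"
    and mean: "\<And>c. c > L \<Longrightarrow> \<exists>m. (\<integral>\<omega>. W m \<omega> \<partial>S) < real m * c"
  shows "AE \<omega> in S. \<forall>c>L. \<forall>\<^sub>F n in sequentially. W n \<omega> / real n < c"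
proof -
  have bdd: "AE \<omega> in S. \<exists>K. \<forall>n. W n \<omega> - real n * c \<le> K" if c: "c > L" for c
  proof -
    obtain m where m: "(\<integral>\<omega>. W m \<omega> \<partial>S) < real m * c"
      using mean[OF c] by blast
    show ?thesis
    proof (rule subadditive_process_bdd_above[where m = m])
      show "W (m + n) \<omega> - real (m + n) * c \<le> W m \<omega> - real m * c + (W n (\<lambda>i. \<omega> (m + i)) - real n * c)" for n \<omega>
        using sub[of m n \<omega>] by (simp add: algebra_simps)
      show "(\<integral>\<omega>. W m \<omega> - real m * c \<partial>S) < 0"
        using m int by (simp add: P.prob_space)
    qed (use int zero dep in auto)
  qed
  have "AE \<omega> in S. \<forall>k. \<exists>K. \<forall>n. W n \<omega> - real n * (L + 1 / Suc k) \<le> K"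
    unfolding AE_all_countable by (intro allI bdd) simp
  then show ?thesis
  proof (rule AE_mp, intro AE_I2 impI allI)
    fix \<omega> c assume *: "\<forall>k. \<exists>K. \<forall>n. W n \<omega> - real n * (L + 1 / Suc k) \<le> K" and c: "L < c"
    obtain k where k: "1 / real (Suc k) < c - L"
      using c by (metis diff_gt_0_iff_gt nat_approx_posE)
    obtain K where K: "\<And>n. W n \<omega> - real n * (L + 1 / Suc k) \<le> K"
      using * by blast
    have "(\<lambda>n. (L + 1 / Suc k) + K * inverse (real n)) \<longlonglongrightarrow> (L + 1 / Suc k) + K * 0"
      by (intro tendsto_intros LIMSEQ_inverse_real_of_nat[THEN LIMSEQ_imp_Suc])
    then have "\<forall>\<^sub>F n in sequentially. (L + 1 / Suc k) + K * inverse (real n) < c"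
      using k by (intro order_tendstoD) (auto simp: algebra_simps)
    then show "\<forall>\<^sub>F n in sequentially. W n \<omega> / real n < c"
      using eventually_gt_at_top[of 0]
    proof eventually_elim
      case (elim n)
      have "W n \<omega> / real n \<le> (real n * (L + 1 / Suc k) + K) / real n"
        using K[of n] by (intro divide_right_mono) auto
      also have "\<dots> = (L + 1 / Suc k) + K * inverse (real n)"
        using elim by (simp add: field_simps)
      finally show ?case using elim by simp
    qed
  qed
qed

end

section \<open>Random walks on groups with a proper left invariant metric\<close>

lemma random_walk_0: "random_walk 0 \<omega> = 0"
  by (simp add: random_walk_def)

lemma random_walk_Suc: "random_walk (Suc n) \<omega> = random_walk n \<omega> + \<omega> n"
  by (simp add: random_walk_def)

lemma random_walk_add: "random_walk (m + n) \<omega> = random_walk m \<omega> + random_walk n (\<lambda>i. \<omega> (m + i))"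
  by (induction n) (simp_all add: random_walk_0 random_walk_Suc add.assoc)

lemma random_walk_case_nat: "random_walk (Suc n) (case_nat s \<omega>) = s + random_walk n \<omega>"
  using random_walk_add[of 1 n "case_nat s \<omega>"] by (simp add: random_walk_Suc random_walk_0)

lemma random_walk_comb_seq: "random_walk n (comb_seq n \<omega> \<omega>') = random_walk n \<omega>"
  unfolding random_walk_def by (auto intro!: arg_cong[where f = sum_list] simp: comb_seq_less)

locale first_moment_walk =
  fixes \<nu> :: "'a::{metric_space, topological_group_add} measure"
  assumes left_invariant: "left_invariant_metric TYPE('a)"
    and proper: "proper_metric TYPE('a)"
    and prob: "prob_space \<nu>"
    and sets_borel [measurable_cong]: "sets \<nu> = sets borel"
    and first_moment: "has_first_moment \<nu>"
begin

sublocale sequence_space \<nu>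
  unfolding sequence_space_def using prob by (intro product_prob_spaceI)

lemma space_nu [simp]: "space \<nu> = UNIV"
  using sets_eq_imp_space_eq[OF sets_borel] by simp

lemma measure_nu_UNIV [simp]: "measure \<nu> UNIV = 1"
  using M.prob_space by simp

lemma increments_eq: "increments \<nu> = S"
  by (simp add: increments_def)

lemma dist_add_left: "dist (g + x) (g + y :: 'a) = dist x y"
  using left_invariant by (simp add: left_invariant_metric_def)

lemma dist_0_add: "dist 0 (g + x :: 'a) = dist (- g) x"
  using dist_add_left[of "- g" 0 "g + x"] by (simp add: add.assoc[symmetric])

lemma dist_0_uminus [simp]: "dist 0 (- g :: 'a) = dist 0 g"
  using dist_0_add[of g 0] dist_0_add[of 0 "-g"] by (metis add.right_neutral dist_commute)

lemma dist_0_add_le: "dist 0 (x + y :: 'a) \<le> dist 0 x + dist 0 y"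
  using dist_triangle[of 0 "x + y" x] dist_add_left[of x 0 y] by simp

lemma measurable_plus [measurable (raw)]:
  assumes "f \<in> N \<rightarrow>\<^sub>M (borel :: 'a measure)" "g \<in> N \<rightarrow>\<^sub>M (borel :: 'a measure)"
  shows "(\<lambda>x. f x + g x) \<in> N \<rightarrow>\<^sub>M (borel :: 'a measure)"
proof -
  obtain D :: "'a set" where D: "countable D" "\<And>x e. e > 0 \<Longrightarrow> \<exists>y\<in>D. dist x y < e"
    using proper_imp_countable_dense[OF proper] by blast
  have "continuous_on UNIV (\<lambda>p :: 'a \<times> 'a. fst p + snd p)"
    unfolding continuous_on_def by (intro ballI tendsto_intros)
  with D have "(\<lambda>p :: 'a \<times> 'a. fst p + snd p) \<in> borel \<Otimes>\<^sub>M borel \<rightarrow>\<^sub>M borel"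
    by (rule borel_measurable_continuous_on_pair)
  from measurable_compose[OF measurable_Pair[OF assms] this] show ?thesis by simp
qed

lemma measurable_dist_const [measurable (raw)]:
  assumes "f \<in> N \<rightarrow>\<^sub>M (borel :: 'a measure)"
  shows "(\<lambda>x. dist a (f x)) \<in> borel_measurable N"
  using assms by (rule measurable_compose) (intro borel_measurable_continuous_onI continuous_intros)

lemma measurable_random_walk [measurable]: "random_walk n \<in> S \<rightarrow>\<^sub>M borel"
  by (induction n) (simp_all add: random_walk_0 random_walk_Suc[abs_def])

lemma integrable_dist_0: "integrable \<nu> (dist 0)"
  using first_moment unfolding has_first_moment_def
  by (intro integrableI_bounded) auto

lemma distr_coordinate: "distr S \<nu> (\<lambda>\<omega>. \<omega> i) = \<nu>"
  using prob by (intro distr_PiM_component) auto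

lemma integrable_coordinate:
  assumes "integrable \<nu> (f :: 'a \<Rightarrow> real)"
  shows "integrable S (\<lambda>\<omega>. f (\<omega> i))"
  using assms integrable_distr[of "\<lambda>\<omega>. \<omega> i" S \<nu> f] by (simp add: distr_coordinate)

lemma integral_coordinate:
  assumes "integrable \<nu> (f :: 'a \<Rightarrow> real)"
  shows "(\<integral>\<omega>. f (\<omega> i) \<partial>S) = (\<integral>x. f x \<partial>\<nu>)"
  using assms integral_distr[of "\<lambda>\<omega>. \<omega> i" S \<nu> f] by (simp add: distr_coordinate)

lemma integrable_dist_random_walk_0: "integrable S (\<lambda>\<omega>. dist 0 (random_walk n \<omega>))"
proof (induction n)
  case (Suc n)
  show ?case
    by (rule Bochner_Integration.integrable_bound[OF Bochner_Integration.integrable_add[OF Suc integrable_coordinate[OF integrable_dist_0, of n]]])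
       (auto simp: random_walk_Suc intro!: dist_0_add_le)
qed (simp add: random_walk_0)

lemma integrable_dist_random_walk: "integrable S (\<lambda>\<omega>. dist a (g + random_walk n \<omega>))"
proof (rule Bochner_Integration.integrable_bound)
  show "integrable S (\<lambda>\<omega>. dist a g + dist 0 (random_walk n \<omega>))"
    using integrable_dist_random_walk_0 by simp
  show "AE \<omega> in S. norm (dist a (g + random_walk n \<omega>)) \<le> norm (dist a g + dist 0 (random_walk n \<omega>))"
  proof (rule AE_I2)
    fix \<omega>
    show "norm (dist a (g + random_walk n \<omega>)) \<le> norm (dist a g + dist 0 (random_walk n \<omega>))"
      using dist_triangle[of a "g + random_walk n \<omega>" g] dist_add_left[of g 0 "random_walk n \<omega>"] by simp
  qed
qed measurable

text \<open>
  By left invariance this is the mean distance from \<open>- g\<close> to \<open>Z\<^sub>n\<close>.  The form with \<open>g\<close> on the left of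
  the walk is the one for which the Markov operator of \<open>\<nu>\<close> acts by a time shift.
\<close>

definition mean_dist :: "nat \<Rightarrow> 'a \<Rightarrow> real" where
  "mean_dist n g = (\<integral>\<omega>. dist 0 (g + random_walk n \<omega>) \<partial>S)"

lemma mean_dist_0: "mean_dist 0 g = dist 0 g"
  by (simp add: mean_dist_def random_walk_0 P.prob_space)

text \<open>
  The Lipschitz estimate is in the right invariant metric \<open>dist (- g) (- g')\<close>, since \<open>mean_dist n g\<close>
  is a mean distance from the point \<open>- g\<close>.
\<close>

lemma mean_dist_lipschitz: "\<bar>mean_dist n g - mean_dist n g'\<bar> \<le> dist (- g) (- g')"
  unfolding mean_dist_def
proof (intro P.expectation_diff_bound integrable_dist_random_walk)
  show "\<bar>dist 0 (g + random_walk n \<omega>) - dist 0 (g' + random_walk n \<omega>)\<bar> \<le> dist (- g) (- g')" for \<omega>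
    using abs_dist_diff_le[of "- g" "random_walk n \<omega>" "- g'"]
    by (simp add: dist_0_add dist_commute[of "- g'" "random_walk n \<omega>"])
qed

text \<open>
  Moving \<open>g\<close> on the left changes the distance by at most \<open>dist 0 k\<close>, whatever \<open>g\<close> is.  This uniform
  bound is what will make the increments \<open>\<phi> (k + g) - \<phi> g\<close> of the limit function bounded.
\<close>

lemma mean_dist_translate: "\<bar>mean_dist n (k + g) - mean_dist n g\<bar> \<le> dist 0 k"
  unfolding mean_dist_def
proof (intro P.expectation_diff_bound integrable_dist_random_walk)
  show "\<bar>dist 0 (k + g + random_walk n \<omega>) - dist 0 (g + random_walk n \<omega>)\<bar> \<le> dist 0 k" for \<omega>
  proof -
    have "dist 0 (k + g + random_walk n \<omega>) = dist (- k) (g + random_walk n \<omega>)"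
      by (simp only: add.assoc dist_0_add)
    moreover have "dist (- k) 0 = dist 0 k"
      by (simp add: dist_commute)
    ultimately show ?thesis
      using abs_dist_diff_le[of "- k" "g + random_walk n \<omega>" 0] dist_commute[of 0 "g + random_walk n \<omega>"]
      by simp
  qed
qed

lemma borel_measurable_inverse_lipschitz:
  fixes f :: "'a \<Rightarrow> real"
  assumes "\<And>g g'. \<bar>f g - f g'\<bar> \<le> dist (- g) (- g')"
  shows "f \<in> borel_measurable borel"
proof (rule borel_measurable_continuous_onI)
  have "(f \<longlongrightarrow> f a) (at a)" for a
  proof (rule metric_tendsto_imp_tendsto)
    show "(uminus \<longlongrightarrow> - a) (at a)"
      by (intro tendsto_intros)
    show "\<forall>\<^sub>F x in at a. dist (f x) (f a) \<le> dist (- x) (- a)"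
      using assms by (simp add: dist_real_def)
  qed
  then show "continuous_on UNIV f"
    by (simp add: continuous_on_def)
qed

lemma integrable_inverse_lipschitz:
  fixes f :: "'a \<Rightarrow> real"
  assumes lip: "\<And>g g'. \<bar>f g - f g'\<bar> \<le> dist (- g) (- g')"
  shows "integrable \<nu> (\<lambda>h. f (g + h))"
proof (rule Bochner_Integration.integrable_bound)
  show "integrable \<nu> (\<lambda>h. \<bar>f 0\<bar> + dist 0 g + dist 0 h)"
    using integrable_dist_0 by simp
  have [measurable]: "f \<in> borel_measurable borel"
    using lip by (rule borel_measurable_inverse_lipschitz)
  show "(\<lambda>h. f (g + h)) \<in> borel_measurable \<nu>"
    by measurable
  have "\<bar>f (g + h)\<bar> \<le> \<bar>f 0\<bar> + dist 0 g + dist 0 h" for h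
    using lip[of "g + h" 0] dist_0_add_le[of g h] dist_0_uminus[of "g + h"]
    by (simp add: dist_commute)
  then show "AE h in \<nu>. norm (f (g + h)) \<le> norm (\<bar>f 0\<bar> + dist 0 g + dist 0 h)"
    by simp
qed

text \<open>
  The first increment of a walk of \<open>n + 1\<close> steps can be split off as an independent variable of law
  \<open>\<nu>\<close>, which then acts on \<open>g\<close> from the right.
\<close>

lemma mean_dist_step: "(\<integral>h. mean_dist n (g + h) \<partial>\<nu>) = mean_dist (Suc n) g"
proof -
  interpret NS: pair_sigma_finite \<nu> S ..
  let ?f = "\<lambda>\<omega>. dist 0 (g + random_walk (Suc n) \<omega>)"
  have c [measurable]: "(\<lambda>(s, \<omega>). case_nat s \<omega>) \<in> \<nu> \<Otimes>\<^sub>M S \<rightarrow>\<^sub>M S"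
    by measurable
  have eq: "?f (case_nat s \<omega>) = dist 0 (g + s + random_walk n \<omega>)" for s \<omega>
    by (simp add: random_walk_case_nat add.assoc)
  have "integrable (distr (\<nu> \<Otimes>\<^sub>M S) S (\<lambda>(s, \<omega>). case_nat s \<omega>)) ?f"
    unfolding PiM_iter by (rule integrable_dist_random_walk)
  then have int: "integrable (\<nu> \<Otimes>\<^sub>M S) (\<lambda>(s, \<omega>). dist 0 (g + s + random_walk n \<omega>))"
    by (subst (asm) integrable_distr_eq) (auto simp: split_beta' eq)
  have "mean_dist (Suc n) g = (\<integral>\<omega>. ?f \<omega> \<partial>distr (\<nu> \<Otimes>\<^sub>M S) S (\<lambda>(s, \<omega>). case_nat s \<omega>))"
    unfolding PiM_iter mean_dist_def ..
  also have "\<dots> = (\<integral>(s, \<omega>). dist 0 (g + s + random_walk n \<omega>) \<partial>(\<nu> \<Otimes>\<^sub>M S))"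
    by (subst integral_distr) (auto simp: split_beta' eq)
  also have "\<dots> = (\<integral>s. (\<integral>\<omega>. dist 0 (g + s + random_walk n \<omega>) \<partial>S) \<partial>\<nu>)"
    using NS.integral_fst'[OF int] by simp
  finally show ?thesis by (simp add: mean_dist_def)
qed

lemma mean_dist_linear_bound: "0 \<le> mean_dist n 0" "mean_dist n 0 \<le> real n * (\<integral>h. dist 0 h \<partial>\<nu>)"
proof -
  show "0 \<le> mean_dist n 0"
    by (simp add: mean_dist_def)
  show "mean_dist n 0 \<le> real n * (\<integral>h. dist 0 h \<partial>\<nu>)"
  proof (induction n)
    case (Suc n)
    have "mean_dist (Suc n) 0 = (\<integral>h. mean_dist n (0 + h) \<partial>\<nu>)"
      by (rule mean_dist_step[symmetric])
    also have "\<dots> \<le> (\<integral>h. mean_dist n 0 + dist 0 h \<partial>\<nu>)"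
    proof (intro integral_mono integrable_inverse_lipschitz mean_dist_lipschitz)
      show "mean_dist n (0 + h) \<le> mean_dist n 0 + dist 0 h" for h
        using mean_dist_translate[of n h 0] by simp
    qed (use integrable_dist_0 in simp)
    also have "\<dots> = mean_dist n 0 + (\<integral>h. dist 0 h \<partial>\<nu>)"
      using integrable_dist_0 by (simp add: M.prob_space)
    finally show ?case using Suc by (simp add: algebra_simps)
  qed (simp add: mean_dist_0)
qed

section \<open>Averaged horofunctions and their limit\<close>

text \<open>
  The functions \<open>g \<mapsto> dist (- g) z - dist 0 z\<close> are those whose limits for \<open>z\<close> tending to infinity are the
  horofunctions of the group.  Here \<open>z\<close> is averaged over the law of \<open>Z\<^sub>n\<close>, and the outcome over the
  first \<open>N\<close> times; the second averaging makes the shift in time telescope.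
\<close>

definition averaged_horofunction :: "nat \<Rightarrow> 'a \<Rightarrow> real" where
  "averaged_horofunction N g = (\<Sum>n<N. mean_dist n g - mean_dist n 0) / real N"

lemma averaged_horofunction_0: "averaged_horofunction N 0 = 0"
  by (simp add: averaged_horofunction_def)

lemma averaged_horofunction_lipschitz:
  "\<bar>averaged_horofunction N g - averaged_horofunction N g'\<bar> \<le> dist (- g) (- g')"
  unfolding averaged_horofunction_def by (intro average_diff_bound mean_dist_lipschitz)

lemma averaged_horofunction_translate:
  "\<bar>averaged_horofunction N (k + g) - averaged_horofunction N g\<bar> \<le> dist 0 k"
  unfolding averaged_horofunction_def by (intro average_diff_bound mean_dist_translate)

text \<open>
  The time shift telescopes, so that the Markov operator adds to the averaged horofunction only a
  boundary term, which is asymptotically the mean speed of the walk at time \<open>N\<close>.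
\<close>

lemma averaged_horofunction_step:
  "(\<integral>h. averaged_horofunction N (g + h) \<partial>\<nu>)
     = averaged_horofunction N g + (mean_dist N g - mean_dist 0 g) / real N"
proof -
  have "(\<integral>h. averaged_horofunction N (g + h) \<partial>\<nu>)
      = (\<Sum>n<N. mean_dist (Suc n) g - mean_dist n 0) / real N"
    unfolding averaged_horofunction_def
    by (simp add: Bochner_Integration.integral_sum Bochner_Integration.integral_diff
        integrable_inverse_lipschitz[OF mean_dist_lipschitz] mean_dist_step M.prob_space)
  also have "(\<Sum>n<N. mean_dist (Suc n) g - mean_dist n 0)
      = (\<Sum>n<N. mean_dist n g - mean_dist n 0) + (mean_dist N g - mean_dist 0 g)"
    by (induction N) auto
  finally show ?thesis
    by (simp add: averaged_horofunction_def add_divide_distrib)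
qed

lemma horofunction_limit:
  obtains r \<phi> l where "strict_mono (r :: nat \<Rightarrow> nat)"
    "\<And>g. (\<lambda>k. averaged_horofunction (r k) g) \<longlonglongrightarrow> \<phi> g"
    "(\<lambda>k. mean_dist (r k) 0 / real (r k)) \<longlonglongrightarrow> l"
proof -
  define b where "b = (\<integral>h. dist 0 h \<partial>\<nu>)"
  have "b \<ge> 0" by (simp add: b_def)
  have "norm (mean_dist n 0 / real n) \<le> b" for n
    using mean_dist_linear_bound[of n] \<open>b \<ge> 0\<close>
    by (cases "n = 0") (auto simp: b_def divide_le_eq mult.commute)
  then have "bounded (range (\<lambda>n. mean_dist n 0 / real n))"
    by (intro boundedI[of _ b]) auto
  then obtain l r1 where r1: "strict_mono (r1 :: nat \<Rightarrow> nat)"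
      "((\<lambda>n. mean_dist n 0 / real n) \<circ> r1) \<longlonglongrightarrow> l"
    using bounded_imp_convergent_subsequence by blast
  obtain D :: "'a set" where D: "countable D" "\<And>x e. e > 0 \<Longrightarrow> \<exists>y\<in>D. dist x y < e"
    using proper_imp_countable_dense[OF proper] by blast
  \<comment> \<open>The averages are bounded by \<open>dist 0 y\<close> pointwise only; dividing makes the bound uniform on \<open>D\<close>.\<close>
  define u where "u n y = averaged_horofunction (r1 n) (- y) / (1 + dist 0 y)" for n y
  have pos: "1 + dist 0 y > 0" for y :: 'a
    by (simp add: add_pos_nonneg)
  have u_bound: "norm (u n y) \<le> 1" for n y
    using averaged_horofunction_translate[of "r1 n" "- y" 0] pos[of y]
    by (simp add: u_def averaged_horofunction_0 abs_divide divide_le_eq)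
  obtain r2 where r2: "strict_mono (r2 :: nat \<Rightarrow> nat)" "\<And>y. y \<in> D \<Longrightarrow> \<exists>l. (\<lambda>n. u (r2 n) y) \<longlonglongrightarrow> l"
    using function_convergent_subsequence[OF D(1), of u 1] u_bound by blast
  have "convergent (\<lambda>n. averaged_horofunction (r1 (r2 n)) (- x))" for x
  proof (rule convergent_if_lipschitz_and_convergent_on_dense[where D = D
        and u = "\<lambda>n x. averaged_horofunction (r1 (r2 n)) (- x)"])
    fix y assume "y \<in> D"
    then obtain l where "(\<lambda>n. u (r2 n) y) \<longlonglongrightarrow> l"
      using r2(2) by blast
    then have "(\<lambda>n. u (r2 n) y * (1 + dist 0 y)) \<longlonglongrightarrow> l * (1 + dist 0 y)"
      by (intro tendsto_intros)
    then show "convergent (\<lambda>n. averaged_horofunction (r1 (r2 n)) (- y))"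
      using pos[of y] by (auto simp: u_def convergent_def)
  next
    show "\<bar>averaged_horofunction (r1 (r2 n)) (- x) - averaged_horofunction (r1 (r2 n)) (- y)\<bar> \<le> dist x y" for n x y
      using averaged_horofunction_lipschitz[of "r1 (r2 n)" "- x" "- y"] by simp
  qed (use D in auto)
  then have "convergent (\<lambda>n. averaged_horofunction (r1 (r2 n)) g)" for g
    by (metis minus_minus)
  then obtain \<phi> where \<phi>: "\<And>g. (\<lambda>n. averaged_horofunction (r1 (r2 n)) g) \<longlonglongrightarrow> \<phi> g"
    unfolding convergent_def by metis
  show thesis
  proof
    show "strict_mono (r1 \<circ> r2)"
      using r1 r2 by (intro strict_mono_o)
    show "(\<lambda>k. averaged_horofunction ((r1 \<circ> r2) k) g) \<longlonglongrightarrow> \<phi> g" for g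
      using \<phi> by simp
    show "(\<lambda>k. mean_dist ((r1 \<circ> r2) k) 0 / real ((r1 \<circ> r2) k)) \<longlonglongrightarrow> l"
      using LIMSEQ_subseq_LIMSEQ[OF r1(2) r2(1)] by (simp add: o_def)
  qed
qed

text \<open>
  The limit function \<open>\<phi>\<close> inherits both Lipschitz bounds, and by dominated convergence (this is where the
  first moment enters) the Markov operator adds to it the constant \<open>l\<close>.  The number \<open>l\<close> is a limit
  of mean speeds along a subsequence only; the last clause is the comparison of \<open>l\<close> with the mean
  speeds that the almost sure upper bound requires.
\<close>

lemma exists_quasi_harmonic_horofunction:
  obtains \<phi> :: "'a \<Rightarrow> real" and l :: real
  where "\<phi> 0 = 0"
    and "\<And>g g'. \<bar>\<phi> g - \<phi> g'\<bar> \<le> dist (- g) (- g')"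
    and "\<And>k g. \<bar>\<phi> (k + g) - \<phi> g\<bar> \<le> dist 0 k"
    and "\<And>g. (\<integral>h. \<phi> (g + h) \<partial>\<nu>) = \<phi> g + l"
    and "\<And>c. c > l \<Longrightarrow> \<exists>m. mean_dist m 0 < real m * c"
proof -
  obtain r \<phi> l where r: "strict_mono (r :: nat \<Rightarrow> nat)"
    and \<phi>: "\<And>g. (\<lambda>k. averaged_horofunction (r k) g) \<longlonglongrightarrow> \<phi> g"
    and l: "(\<lambda>k. mean_dist (r k) 0 / real (r k)) \<longlonglongrightarrow> l"
    by (rule horofunction_limit) blast
  have lip: "\<bar>\<phi> g - \<phi> g'\<bar> \<le> dist (- g) (- g')" for g g'
    by (rule LIMSEQ_le_const2[OF tendsto_rabs[OF tendsto_diff[OF \<phi> \<phi>]]])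
       (use averaged_horofunction_lipschitz in auto)
  have trans: "\<bar>\<phi> (k + g) - \<phi> g\<bar> \<le> dist 0 k" for k g
    by (rule LIMSEQ_le_const2[OF tendsto_rabs[OF tendsto_diff[OF \<phi> \<phi>]]])
       (use averaged_horofunction_translate in auto)
  have zero: "\<phi> 0 = 0"
    using LIMSEQ_unique[OF \<phi>[of 0]] by (simp add: averaged_horofunction_0)
  have r_top: "filterlim r at_top sequentially"
    using r by (rule filterlim_subseq)
  have step: "(\<integral>h. \<phi> (g + h) \<partial>\<nu>) = \<phi> g + l" for g
  proof (rule LIMSEQ_unique)
    note [measurable] = borel_measurable_inverse_lipschitz[OF lip]
      borel_measurable_inverse_lipschitz[OF averaged_horofunction_lipschitz]
    show "(\<lambda>k. \<integral>h. averaged_horofunction (r k) (g + h) \<partial>\<nu>) \<longlonglongrightarrow> (\<integral>h. \<phi> (g + h) \<partial>\<nu>)"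
    proof (rule integral_dominated_convergence[where w = "\<lambda>h. dist 0 g + dist 0 h"])
      show "integrable \<nu> (\<lambda>h. dist 0 g + dist 0 h)"
        using integrable_dist_0 by simp
      have "\<bar>averaged_horofunction (r k) (g + h)\<bar> \<le> dist 0 g + dist 0 h" for k h
        using averaged_horofunction_translate[of "r k" "g + h" 0] dist_0_add_le[of g h]
        by (simp add: averaged_horofunction_0)
      then show "AE h in \<nu>. norm (averaged_horofunction (r k) (g + h)) \<le> dist 0 g + dist 0 h" for k
        by simp
    qed (use \<phi> in auto)
    \<comment> \<open>The mean speed seen from \<open>g\<close> and the one seen from the identity have the same limit.\<close>
    have "(\<lambda>k. (mean_dist (r k) g - mean_dist 0 g - mean_dist (r k) 0) / real (r k)) \<longlonglongrightarrow> 0"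
    proof (rule Lim_null_comparison)
      show "\<forall>\<^sub>F k in sequentially. norm ((mean_dist (r k) g - mean_dist 0 g - mean_dist (r k) 0) / real (r k))
          \<le> 2 * dist 0 g * inverse (real (r k))"
      proof (rule always_eventually, rule allI)
        fix k
        have "\<bar>mean_dist (r k) g - mean_dist 0 g - mean_dist (r k) 0\<bar> \<le> 2 * dist 0 g"
          using mean_dist_translate[of "r k" g 0] by (simp add: mean_dist_0)
        then show "norm ((mean_dist (r k) g - mean_dist 0 g - mean_dist (r k) 0) / real (r k))
          \<le> 2 * dist 0 g * inverse (real (r k))"
          by (simp add: divide_inverse abs_mult mult_right_mono)
      qed
      show "(\<lambda>k. 2 * dist 0 g * inverse (real (r k))) \<longlonglongrightarrow> 0"
        by (intro tendsto_mult_right_zero filterlim_compose[OF lim_inverse_n r_top])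
    qed
    then have "(\<lambda>k. averaged_horofunction (r k) g + (mean_dist (r k) 0 / real (r k)
        + (mean_dist (r k) g - mean_dist 0 g - mean_dist (r k) 0) / real (r k))) \<longlonglongrightarrow> \<phi> g + (l + 0)"
      by (intro tendsto_add \<phi> l)
    then show "(\<lambda>k. \<integral>h. averaged_horofunction (r k) (g + h) \<partial>\<nu>) \<longlonglongrightarrow> \<phi> g + l"
      by (simp add: averaged_horofunction_step add_divide_distrib[symmetric])
  qed
  have mean: "\<exists>m. mean_dist m 0 < real m * c" if "c > l" for c
  proof -
    have "\<forall>\<^sub>F k in sequentially. mean_dist (r k) 0 / real (r k) < c"
      using l that by (rule order_tendstoD)
    moreover have "\<forall>\<^sub>F k in sequentially. r k > 0"
      using r_top eventually_gt_at_top[of "0::nat"] by (rule filterlim_iff[THEN iffD1, rule_format])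
    ultimately have "\<forall>\<^sub>F k in sequentially. mean_dist (r k) 0 < real (r k) * c"
      by eventually_elim (simp add: divide_less_eq mult.commute)
    then show ?thesis
      using eventually_happens'[OF sequentially_bot] by blast
  qed
  show thesis
    by (rule that[OF zero lip trans step mean])
qed

section \<open>The Liouville property and the drift\<close>

text \<open>
  Since the Markov operator adds the same constant to \<open>\<phi>\<close> at \<open>g\<close> and at \<open>k + g\<close>, the function
  \<open>g \<mapsto> \<phi> (k + g) - \<phi> g\<close> is harmonic, and it is bounded by \<open>dist 0 k\<close>.  The Liouville property
  makes it equal to its value \<open>\<phi> k\<close> at the identity, so \<open>\<phi>\<close> is a homomorphism.
\<close>

lemma liouville_imp_drift_homomorphism:
  assumes "liouville \<nu>"
  obtains T :: "'a \<Rightarrow> real"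
  where "\<And>g h. T (g + h) = T g + T h"
    and "\<And>g. \<bar>T g\<bar> \<le> dist 0 g"
    and "integrable \<nu> T"
    and "\<And>c. c > (\<integral>g. T g \<partial>\<nu>) \<Longrightarrow> \<exists>m. mean_dist m 0 < real m * c"
proof -
  obtain \<phi> l where zero: "\<phi> 0 = 0"
    and lip: "\<And>g g'. \<bar>\<phi> g - \<phi> g'\<bar> \<le> dist (- g) (- g')"
    and trans: "\<And>k g. \<bar>\<phi> (k + g) - \<phi> g\<bar> \<le> dist 0 k"
    and step: "\<And>g. (\<integral>h. \<phi> (g + h) \<partial>\<nu>) = \<phi> g + l"
    and mean: "\<And>c. c > l \<Longrightarrow> \<exists>m. mean_dist m 0 < real m * c"
    by (rule exists_quasi_harmonic_horofunction) blast
  note [measurable] = borel_measurable_inverse_lipschitz[OF lip]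
  have "bounded_harmonic \<nu> (\<lambda>g. \<phi> (k + g) - \<phi> g)" for k
    unfolding bounded_harmonic_def
  proof (intro conjI allI)
    show "(\<lambda>g. \<phi> (k + g) - \<phi> g) \<in> borel_measurable borel"
      by measurable
    show "bounded (range (\<lambda>g. \<phi> (k + g) - \<phi> g))"
      by (rule boundedI[of _ "dist 0 k"]) (use trans in auto)
    show "\<phi> (k + g) - \<phi> g = (\<integral>h. \<phi> (k + (g + h)) - \<phi> (g + h) \<partial>\<nu>)" for g
      using integrable_inverse_lipschitz[OF lip, of "k + g"] integrable_inverse_lipschitz[OF lip, of g]
        step[of "k + g"] step[of g] by (simp add: add.assoc)
  qed
  then have "\<exists>c. \<forall>g. \<phi> (k + g) - \<phi> g = c" for k
    using assms by (simp add: liouville_def)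
  then have hom: "\<phi> (k + g) = \<phi> k + \<phi> g" for k g
    by (metis add.right_neutral diff_add_cancel diff_zero zero)
  have "(\<integral>g. \<phi> g \<partial>\<nu>) = l"
    using step[of 0] zero by simp
  moreover have "\<bar>\<phi> g\<bar> \<le> dist 0 g" for g
    using trans[of g 0] zero by simp
  moreover have "integrable \<nu> \<phi>"
    using integrable_inverse_lipschitz[OF lip, of 0] by simp
  ultimately show thesis
    using that[OF hom] mean by blast
qed

text \<open>
  The walk cannot escape faster than at rate \<open>\<integral> T\<close>, by the subadditive bound applied to the distance.
  It cannot be slower either: the distance dominates \<open>T (Z\<^sub>n)\<close>, a sum of independent variables of mean
  \<open>\<integral> T\<close>, whose lower growth rate is bounded by applying the same subadditive bound to \<open>- T (Z\<^sub>n)\<close>.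
  Both sequences are squeezed between these two rates.
\<close>

lemma random_walk_limits:
  fixes T :: "'a \<Rightarrow> real"
  assumes hom: "\<And>g h. T (g + h) = T g + T h"
    and bound: "\<And>g. \<bar>T g\<bar> \<le> dist 0 g"
    and int: "integrable \<nu> T"
    and mean: "\<And>c. c > (\<integral>g. T g \<partial>\<nu>) \<Longrightarrow> \<exists>m. mean_dist m 0 < real m * c"
  shows "AE \<omega> in S. (\<lambda>n. T (random_walk n \<omega>) / real n) \<longlonglongrightarrow> (\<integral>g. T g \<partial>\<nu>)
            \<and> (\<lambda>n. dist 0 (random_walk n \<omega>) / real n) \<longlonglongrightarrow> (\<integral>g. T g \<partial>\<nu>)"
proof -
  let ?l = "\<integral>g. T g \<partial>\<nu>"
  have T0: "T 0 = 0" using bound[of 0] by simp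
  have upper: "AE \<omega> in S. \<forall>c>?l. \<forall>\<^sub>F n in sequentially. dist 0 (random_walk n \<omega>) / real n < c"
  proof (rule subadditive_process_upper_growth)
    show "dist 0 (random_walk (m + n) \<omega>) \<le> dist 0 (random_walk m \<omega>) + dist 0 (random_walk n (\<lambda>i. \<omega> (m + i)))" for m n and \<omega> :: "nat \<Rightarrow> 'a"
      unfolding random_walk_add by (rule dist_0_add_le)
    show "\<exists>m. (\<integral>\<omega>. dist 0 (random_walk m \<omega>) \<partial>S) < real m * c" if "c > ?l" for c
      using mean[OF that] by (simp add: mean_dist_def)
  qed (simp_all add: integrable_dist_random_walk_0 random_walk_0 random_walk_comb_seq)
  have [measurable]: "T \<in> borel_measurable borel"
    using borel_measurable_integrable[OF int] by (simp add: measurable_cong_sets[OF sets_borel refl])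
  have "AE \<omega> in S. \<forall>c>- ?l. \<forall>\<^sub>F n in sequentially. - T (random_walk n \<omega>) / real n < c"
  proof (rule subadditive_process_upper_growth)
    show "integrable S (\<lambda>\<omega>. - T (random_walk n \<omega>))" for n
      by (rule Bochner_Integration.integrable_bound[OF integrable_dist_random_walk_0[of n]])
         (use bound in auto)
    \<comment> \<open>A single step suffices, since \<open>- T (Z\<^sub>n)\<close> is additive.\<close>
    show "\<exists>m. (\<integral>\<omega>. - T (random_walk m \<omega>) \<partial>S) < real m * c" if "c > - ?l" for c
      using that integral_coordinate[OF int, of 0]
      by (intro exI[of _ 1]) (simp add: random_walk_Suc random_walk_0)
  qed (simp_all add: random_walk_0 T0 random_walk_add hom random_walk_comb_seq)
  with upper show ?thesis
  proof eventually_elim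
    case (elim \<omega>)
    have T_le: "T (random_walk n \<omega>) / real n \<le> dist 0 (random_walk n \<omega>) / real n" for n
      using bound[of "random_walk n \<omega>"] by (intro divide_right_mono) auto
    have up: "\<forall>\<^sub>F n in sequentially. dist 0 (random_walk n \<omega>) / real n < c" if "c > ?l" for c
      using elim that by blast
    have low: "\<forall>\<^sub>F n in sequentially. c < T (random_walk n \<omega>) / real n" if "c < ?l" for c
      using elim(2)[rule_format, of "- c"] that by simp
    have "(\<lambda>n. T (random_walk n \<omega>) / real n) \<longlonglongrightarrow> ?l"
      by (rule order_tendstoI[OF low])
         (auto intro: eventually_mono[OF up] order.strict_trans1[OF T_le])
    moreover have "(\<lambda>n. dist 0 (random_walk n \<omega>) / real n) \<longlonglongrightarrow> ?l"
      by (rule order_tendstoI[OF _ up])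
         (auto intro: eventually_mono[OF low] order.strict_trans2[OF _ T_le])
    ultimately show ?case ..
  qed
qed

lemma linear_drift_eqI:
  assumes "AE \<omega> in increments \<nu>. (\<lambda>n. dist 0 (random_walk n \<omega>) / real n) \<longlonglongrightarrow> l"
  shows "linear_drift \<nu> = l"
  unfolding linear_drift_def
proof (rule the_equality)
  fix l' assume "AE \<omega> in increments \<nu>. (\<lambda>n. dist 0 (random_walk n \<omega>) / real n) \<longlonglongrightarrow> l'"
  with assms have "AE \<omega> in increments \<nu>. l' = l"
    by eventually_elim (rule LIMSEQ_unique)
  then show "l' = l"
    unfolding increments_eq by (simp only: P.AE_const)
qed (rule assms)

end

theorem corollary19:
  fixes \<nu> :: "'a::{metric_space, topological_group_add} measure"
  assumes "locally compact (UNIV :: 'a set)"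
    and "left_invariant_metric TYPE('a)"
    and "proper_metric TYPE('a)"
    and "prob_space \<nu>"
    and "sets \<nu> = sets borel"
    and "nondegenerate \<nu>"
    and "has_first_moment \<nu>"
    and "liouville \<nu>"
  shows "\<exists>T :: 'a \<Rightarrow> real.
           1-lipschitz_on UNIV T \<and>
           (\<forall>g h. T (g + h) = T g + T h) \<and>
           (AE \<omega> in increments \<nu>.
              (\<lambda>n. T (random_walk n \<omega>) / real n) \<longlonglongrightarrow> (\<integral>g. T g \<partial>\<nu>)) \<and>
           (\<integral>g. T g \<partial>\<nu>) = linear_drift \<nu>"
proof -
  interpret first_moment_walk \<nu>
    using assms by (intro first_moment_walk.intro)
  obtain T :: "'a \<Rightarrow> real" where T: "\<And>g h. T (g + h) = T g + T h" "\<And>g. \<bar>T g\<bar> \<le> dist 0 g"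
      "integrable \<nu> T" "\<And>c. c > (\<integral>g. T g \<partial>\<nu>) \<Longrightarrow> \<exists>m. mean_dist m 0 < real m * c"
    using liouville_imp_drift_homomorphism[OF assms(8)] by blast
  have lim: "AE \<omega> in increments \<nu>. (\<lambda>n. T (random_walk n \<omega>) / real n) \<longlonglongrightarrow> (\<integral>g. T g \<partial>\<nu>)
            \<and> (\<lambda>n. dist 0 (random_walk n \<omega>) / real n) \<longlonglongrightarrow> (\<integral>g. T g \<partial>\<nu>)"
    unfolding increments_eq by (rule random_walk_limits[OF T])
  have "1-lipschitz_on UNIV T"
  proof (rule lipschitz_onI)
    fix x y
    have "T x = T y + T (- y + x)"
      by (simp add: T(1)[symmetric] add.assoc[symmetric])
    then show "dist (T x) (T y) \<le> 1 * dist x y"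
      using T(2)[of "- y + x"] dist_0_add[of "- y" x] by (simp add: dist_real_def dist_commute)
  qed simp
  moreover have "linear_drift \<nu> = (\<integral>g. T g \<partial>\<nu>)"
    by (rule linear_drift_eqI) (use lim in eventually_elim, simp)
  moreover have "AE \<omega> in increments \<nu>. (\<lambda>n. T (random_walk n \<omega>) / real n) \<longlonglongrightarrow> (\<integral>g. T g \<partial>\<nu>)"
    using lim by eventually_elim simp
  ultimately show ?thesis
    using T(1) by (intro exI[of _ T]) simp
qed

end
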